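(* Let $G$ be an infinite countable discrete amenable group with a F\o lner sequence $\mathbf{F}$, and let $(X,G)$ be a $G$-system. Then $(X,G)$ is null if and only if $SE(X,G)=\emptyset$.
   Context: The F\o lner sequence $\mathbf{F}=\{F_n\}_{n=1}^\infty$ is a sequence of finite subsets of $G$ with $\lim_{n\to\infty}|gF_n\triangle F_n|/|F_n|=0$ for every $g\in G$, $e_G\in F_1\subseteq F_2\subseteq\cdots$ and $\bigcup_n F_n=G$. A $G$-system $(X,G)$ is a compact metric space $X$ with a continuous action of $G$. For a finite open cover $\mathcal{U}$ of $X$, $\mathcal{N}(\mathcal{U})$ is the minimal cardinality of a subcover, $g^{-1}\mathcal{U}=\{g^{-1}U:U\in\mathcal{U}\}$, and $\bigvee$ denotes the common refinement. For an infinite subset $S\subset G$, $$h_{\mathrm{top}}^{S,\mathbf{F}}(G,\mathcal{U})=\limsup_{n\to\infty}\frac{1}{|S\cap F_n|}\log\mathcal{N}\Big(\bigvee_{g\in S\cap F_n}g^{-1}\mathcal{U}\Big),\qquad h_{\mathrm{top}}^{S,\mathbf{F}}(G)=\sup_{\mathcal{U}}h_{\mathrm{top}}^{S,\mathbf{F}}(G,\mathcal{U}),$$ the supremum being over all finite open covers of $X$. The system $(X,G)$ is null if $h_{\mathrm{top}}^{S,\mathbf{F}}(G)=0$ for every infinite subset $S\subset G$. A pair $(x_1,x_2)\in X\times X$ is a sequence entropy pair if $x_1\neq x_2$ and, whenever $U_1,U_2$ are disjoint closed neighborhoods of $x_1,x_2$ respectively, there exists an infinite subset $S\subset G$ such that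 $h_{\mathrm{top}}^{S,\mathbf{F}}(G,\{X\setminus U_1,X\setminus U_2\})>0$. $SE(X,G)$ denotes the set of all sequence entropy pairs. *)

theory Defs
  imports "HOL-Analysis.Analysis" "HOL-Algebra.Group_Action"
begin

text \<open>Sequences start at index 0 here, so \<open>F 0\<close> plays the role of \<open>F\<^sub>1\<close>;
  the definitions below are insensitive to this shift.\<close>

definition asymptotically_invariant :: "('g, 'm) monoid_scheme \<Rightarrow> (nat \<Rightarrow> 'g set) \<Rightarrow> bool"
  where "asymptotically_invariant G F \<longleftrightarrow>
    (\<forall>n. finite (F n) \<and> F n \<noteq> {} \<and> F n \<subseteq> carrier G) \<and>
    (\<forall>g\<in>carrier G.
      (\<lambda>n. real (card (sym_diff (g <#\<^bsub>G\<^esub> F n) (F n))) / real (card (F n))) \<longlonglongrightarrow> 0)"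

text \<open>Amenability of a countable discrete group, via Foelner's condition.\<close>

definition amenable :: "('g, 'm) monoid_scheme \<Rightarrow> bool"
  where "amenable G \<longleftrightarrow> (\<exists>F. asymptotically_invariant G F)"

definition folner_sequence :: "('g, 'm) monoid_scheme \<Rightarrow> (nat \<Rightarrow> 'g set) \<Rightarrow> bool"
  where "folner_sequence G F \<longleftrightarrow>
    asymptotically_invariant G F \<and>
    \<one>\<^bsub>G\<^esub> \<in> F 0 \<and> (\<forall>n. F n \<subseteq> F (Suc n)) \<and> (\<Union>n. F n) = carrier G"

text \<open>\<open>X\<close> is a compact subset of a metric space, viewed as a metric space in its own right;
  openness, closedness and neighbourhoods below are all relative to \<open>X\<close>.
  The empty space is not excluded: since \<open>ln 0 = 0\<close>, all its entropies are 0.\<close>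

definition G_system ::
    "('g, 'm) monoid_scheme \<Rightarrow> 'x::metric_space set \<Rightarrow> ('g \<Rightarrow> 'x \<Rightarrow> 'x) \<Rightarrow> bool"
  where "G_system G X \<phi> \<longleftrightarrow>
    compact X \<and> group_action G X \<phi> \<and>
    continuous_map (prod_topology (discrete_topology (carrier G)) (top_of_set X)) (top_of_set X)
      (\<lambda>(g, x). \<phi> g x)"

definition finite_open_cover :: "'x::topological_space set \<Rightarrow> 'x set set \<Rightarrow> bool"
  where "finite_open_cover X \<U> \<longleftrightarrow>
    finite \<U> \<and> (\<forall>U\<in>\<U>. openin (top_of_set X) U) \<and> \<Union>\<U> = X"

definition cover_number :: "'x set \<Rightarrow> 'x set set \<Rightarrow> nat"
  where "cover_number X \<U> = (LEAST k. \<exists>\<V>\<subseteq>\<U>. finite \<V> \<and> \<Union>\<V> = X \<and> card \<V> = k)"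

definition translate_cover ::
    "('g, 'm) monoid_scheme \<Rightarrow> ('g \<Rightarrow> 'x \<Rightarrow> 'x) \<Rightarrow> 'g \<Rightarrow> 'x set set \<Rightarrow> 'x set set"
  where "translate_cover G \<phi> g \<U> = (\<lambda>U. \<phi> (inv\<^bsub>G\<^esub> g) ` U) ` \<U>"

text \<open>Intersecting with \<open>X\<close> makes the join over an empty index set the trivial cover \<open>{X}\<close>.\<close>

definition common_refinement :: "'x set \<Rightarrow> 'i set \<Rightarrow> ('i \<Rightarrow> 'x set set) \<Rightarrow> 'x set set"
  where "common_refinement X I \<W> = {X \<inter> (\<Inter>i\<in>I. V i) | V. \<forall>i\<in>I. V i \<in> \<W> i}"

text \<open>For infinite \<open>S\<close> the sets \<open>S \<inter> F n\<close> are eventually nonempty along a Foelner sequence,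
  so the totalised division by zero does not affect the upper limit.\<close>

definition seq_entropy_cover ::
    "('g, 'm) monoid_scheme \<Rightarrow> 'x set \<Rightarrow> ('g \<Rightarrow> 'x \<Rightarrow> 'x) \<Rightarrow> (nat \<Rightarrow> 'g set) \<Rightarrow>
     'g set \<Rightarrow> 'x set set \<Rightarrow> ereal"
  where "seq_entropy_cover G X \<phi> F S \<U> =
    limsup (\<lambda>n. ereal (1 / real (card (S \<inter> F n)) *
      ln (real (cover_number X
        (common_refinement X (S \<inter> F n) (\<lambda>g. translate_cover G \<phi> g \<U>))))))"

definition seq_entropy ::
    "('g, 'm) monoid_scheme \<Rightarrow> 'x::topological_space set \<Rightarrow> ('g \<Rightarrow> 'x \<Rightarrow> 'x) \<Rightarrow>
     (nat \<Rightarrow> 'g set) \<Rightarrow> 'g set \<Rightarrow> ereal"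
  where "seq_entropy G X \<phi> F S =
    (SUP \<U>\<in>{\<U>. finite_open_cover X \<U>}. seq_entropy_cover G X \<phi> F S \<U>)"

definition null_system ::
    "('g, 'm) monoid_scheme \<Rightarrow> 'x::topological_space set \<Rightarrow> ('g \<Rightarrow> 'x \<Rightarrow> 'x) \<Rightarrow>
     (nat \<Rightarrow> 'g set) \<Rightarrow> bool"
  where "null_system G X \<phi> F \<longleftrightarrow>
    (\<forall>S. S \<subseteq> carrier G \<and> infinite S \<longrightarrow> seq_entropy G X \<phi> F S = 0)"

definition closed_nbhd :: "'x::topological_space set \<Rightarrow> 'x \<Rightarrow> 'x set \<Rightarrow> bool"
  where "closed_nbhd X x U \<longleftrightarrow>
    closedin (top_of_set X) U \<and> x \<in> (top_of_set X) interior_of U"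

definition sequence_entropy_pairs ::
    "('g, 'm) monoid_scheme \<Rightarrow> 'x::topological_space set \<Rightarrow> ('g \<Rightarrow> 'x \<Rightarrow> 'x) \<Rightarrow>
     (nat \<Rightarrow> 'g set) \<Rightarrow> ('x \<times> 'x) set"
  where "sequence_entropy_pairs G X \<phi> F =
    {(x1, x2) \<in> X \<times> X. x1 \<noteq> x2 \<and>
      (\<forall>U1 U2. closed_nbhd X x1 U1 \<and> closed_nbhd X x2 U2 \<and> U1 \<inter> U2 = {} \<longrightarrow>
        (\<exists>S. S \<subseteq> carrier G \<and> infinite S \<and>
          seq_entropy_cover G X \<phi> F S {X - U1, X - U2} > 0))}"

end

theory Submission
  imports Defs
begin

text \<open>If the system is null, the cover by the complements of two disjoint closed balls has zero
  entropy, so no pair is a sequence entropy pair. Conversely, if there is no sequence entropy pair,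
  any two distinct points have closed neighbourhoods \<open>A\<close>, \<open>B\<close> for which \<open>{X - A, X - B}\<close> has zero
  entropy along every sequence. Zero entropy passes to finite joins and to coarser covers, and two
  compactness arguments show that every finite open cover is coarser than a finite join of such
  two-element covers: first the complement of a neighbourhood \<open>U\<close> of a point \<open>x\<close> is covered by
  finitely many \<open>B\<close>'s, which gives a neighbourhood \<open>N\<close> of \<open>x\<close> for which \<open>{X - N, U}\<close> has zero
  entropy, and then \<open>X\<close> itself is covered by finitely many such \<open>N\<close>'s.\<close>

section \<open>Finite covers, refinement and cover numbers\<close>

text \<open>Set-theoretic covers: all counting is done for these, and openness enters only with
  compactness.\<close>

definition finite_cover :: "'x set \<Rightarrow> 'x set set \<Rightarrow> bool"
  where "finite_cover X \<U> \<longleftrightarrow> finite \<U> \<and> \<Union>\<U> = X"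

text \<open>Exempting the empty set keeps the empty cover of the empty space comparable with \<open>{{}}\<close>.\<close>

definition refines :: "'x set set \<Rightarrow> 'x set set \<Rightarrow> bool"
  where "refines \<V> \<U> \<longleftrightarrow> (\<forall>V\<in>\<V>. V \<noteq> {} \<longrightarrow> (\<exists>U\<in>\<U>. V \<subseteq> U))"

text \<open>The binary join, over which translation distributes and from which finite joins are
  built one factor at a time.\<close>

definition join :: "'x set set \<Rightarrow> 'x set set \<Rightarrow> 'x set set"
  where "join \<U> \<V> = (\<lambda>(A, B). A \<inter> B) ` (\<U> \<times> \<V>)"

lemma finite_cover_join:
  assumes "finite_cover X \<U>" "finite_cover X \<V>"
  shows "finite_cover X (join \<U> \<V>)"
  using assms unfolding finite_cover_def join_def by fastforce

lemma cover_number_le: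
  assumes "finite \<V>" "\<V> \<subseteq> \<U>" "\<Union>\<V> = X"
  shows "cover_number X \<U> \<le> card \<V>"
  unfolding cover_number_def by (rule Least_le) (use assms in blast)

lemma minimal_subcover:
  assumes "finite_cover X \<U>"
  obtains \<V> where "finite \<V>" "\<V> \<subseteq> \<U>" "\<Union>\<V> = X" "card \<V> = cover_number X \<U>"
proof -
  have "\<exists>k. \<exists>\<V>\<subseteq>\<U>. finite \<V> \<and> \<Union>\<V> = X \<and> card \<V> = k"
    using assms unfolding finite_cover_def by blast
  from LeastI_ex[OF this] show ?thesis
    using that unfolding cover_number_def by blast
qed

text \<open>Replacing each nonempty member of a minimal subcover of \<open>\<V>\<close> by a member
  of \<open>\<U>\<close> containing it yields a subcover of \<open>\<U>\<close> that is no
  larger.\<close>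

lemma cover_number_mono:
  assumes "finite_cover X \<U>" "finite_cover X \<V>" "refines \<V> \<U>"
  shows "cover_number X \<U> \<le> cover_number X \<V>"
proof -
  obtain \<V>' where v: "finite \<V>'" "\<V>' \<subseteq> \<V>" "\<Union>\<V>' = X" "card \<V>' = cover_number X \<V>"
    using minimal_subcover[OF assms(2)] .
  have "\<forall>V\<in>\<V>' - {{}}. \<exists>U\<in>\<U>. V \<subseteq> U"
    using assms(3) v(2) unfolding refines_def by blast
  then obtain f where f: "\<And>V. V \<in> \<V>' - {{}} \<Longrightarrow> f V \<in> \<U> \<and> V \<subseteq> f V"
    by metis
  let ?\<W> = "f ` (\<V>' - {{}})"
  have "?\<W> \<subseteq> \<U>" using f by blast
  moreover have "\<Union>?\<W> = X"
  proof
    show "\<Union>?\<W> \<subseteq> X"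
      using assms(1) \<open>?\<W> \<subseteq> \<U>\<close> unfolding finite_cover_def by blast
    show "X \<subseteq> \<Union>?\<W>" using v(3) f by blast
  qed
  ultimately have "cover_number X \<U> \<le> card ?\<W>"
    using v(1) by (intro cover_number_le) auto
  also have "\<dots> \<le> card (\<V>' - {{}})" using v(1) by (intro card_image_le) simp
  also have "\<dots> \<le> card \<V>'" using v(1) by (intro card_mono) auto
  finally show ?thesis using v(4) by simp
qed

text \<open>Pairwise intersections of two minimal subcovers form a subcover of the join.\<close>

lemma cover_number_join:
  assumes "finite_cover X \<U>" "finite_cover X \<V>"
  shows "cover_number X (join \<U> \<V>) \<le> cover_number X \<U> * cover_number X \<V>"
proof -
  obtain \<U>' where u: "finite \<U>'" "\<U>' \<subseteq> \<U>" "\<Union>\<U>' = X" "card \<U>' = cover_number X \<U>"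
    using minimal_subcover[OF assms(1)] .
  obtain \<V>' where v: "finite \<V>'" "\<V>' \<subseteq> \<V>" "\<Union>\<V>' = X" "card \<V>' = cover_number X \<V>"
    using minimal_subcover[OF assms(2)] .
  have "finite_cover X (join \<U>' \<V>')"
    using u v by (intro finite_cover_join) (auto simp: finite_cover_def)
  then have "cover_number X (join \<U> \<V>) \<le> card (join \<U>' \<V>')"
    using u v by (intro cover_number_le) (auto simp: finite_cover_def join_def)
  also have "\<dots> \<le> card (\<U>' \<times> \<V>')"
    unfolding join_def using u v by (intro card_image_le) simp
  finally show ?thesis using u v by (simp add: card_cartesian_product)
qed

section \<open>Common refinements over an index set\<close>

lemma common_refinementI:
  assumes "\<And>i. i \<in> I \<Longrightarrow> V i \<in> \<W> i"
  shows "X \<inter> (\<Inter>i\<in>I. V i) \<in> common_refinement X I \<W>"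
  using assms unfolding common_refinement_def by blast

lemma common_refinementE:
  assumes "E \<in> common_refinement X I \<W>"
  obtains V where "E = X \<inter> (\<Inter>i\<in>I. V i)" "\<forall>i\<in>I. V i \<in> \<W> i"
  using assms unfolding common_refinement_def by blast

lemma finite_common_refinement:
  assumes "finite I" "\<And>i. i \<in> I \<Longrightarrow> finite (\<W> i)"
  shows "finite (common_refinement X I \<W>)"
proof -
  \<comment> \<open>Choice functions are unconstrained off \<open>I\<close>, but only their
    restriction to \<open>I\<close> matters, and those restrictions form a finite product.\<close>
  have "common_refinement X I \<W> \<subseteq> (\<lambda>V. X \<inter> (\<Inter>i\<in>I. V i)) ` (Pi\<^sub>E I \<W>)"
  proof
    fix E assume "E \<in> common_refinement X I \<W>"
    then obtain V where V: "E = X \<inter> (\<Inter>i\<in>I. V i)" "\<forall>i\<in>I. V i \<in> \<W> i"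
      by (rule common_refinementE)
    then show "E \<in> (\<lambda>V. X \<inter> (\<Inter>i\<in>I. V i)) ` (Pi\<^sub>E I \<W>)"
      by (intro image_eqI[where x = "restrict V I"]) auto
  qed
  then show ?thesis
    by (rule finite_subset) (intro finite_imageI finite_PiE assms)
qed

lemma finite_cover_common_refinement:
  assumes "finite I" "\<And>i. i \<in> I \<Longrightarrow> finite_cover X (\<W> i)"
  shows "finite_cover X (common_refinement X I \<W>)"
  unfolding finite_cover_def
proof
  show "finite (common_refinement X I \<W>)"
    using assms by (intro finite_common_refinement) (auto simp: finite_cover_def)
  show "\<Union>(common_refinement X I \<W>) = X"
  proof
    show "X \<subseteq> \<Union>(common_refinement X I \<W>)"
    proof
      fix x assume x: "x \<in> X"
      then have "\<forall>i\<in>I. \<exists>V\<in>\<W> i. x \<in> V"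
        using assms(2) unfolding finite_cover_def by blast
      then obtain V where "\<forall>i\<in>I. V i \<in> \<W> i \<and> x \<in> V i" by metis
      then show "x \<in> \<Union>(common_refinement X I \<W>)"
        using x unfolding common_refinement_def by blast
    qed
  qed (auto simp: common_refinement_def)
qed

lemma refines_common_refinement:
  assumes "\<And>i. i \<in> I \<Longrightarrow> refines (\<W> i) (\<W>' i)"
  shows "refines (common_refinement X I \<W>) (common_refinement X I \<W>')"
  unfolding refines_def
proof (intro ballI impI)
  fix E assume E: "E \<in> common_refinement X I \<W>" and ne: "E \<noteq> {}"
  obtain V where V: "E = X \<inter> (\<Inter>i\<in>I. V i)" "\<forall>i\<in>I. V i \<in> \<W> i"
    using E by (rule common_refinementE)
  have "\<exists>U\<in>\<W>' i. V i \<subseteq> U" if "i \<in> I" for i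
  proof -
    \<comment> \<open>\<open>refines\<close> says nothing about empty sets, but a nonempty cell has
      only nonempty factors.\<close>
    have "V i \<noteq> {}" using V(1) ne that by blast
    then show ?thesis using V(2) that assms[OF that] unfolding refines_def by simp
  qed
  then obtain U where U: "\<And>i. i \<in> I \<Longrightarrow> U i \<in> \<W>' i \<and> V i \<subseteq> U i" by metis
  then have "X \<inter> (\<Inter>i\<in>I. U i) \<in> common_refinement X I \<W>'"
    by (intro common_refinementI) simp
  moreover have "E \<subseteq> X \<inter> (\<Inter>i\<in>I. U i)" using V U by blast
  ultimately show "\<exists>U\<in>common_refinement X I \<W>'. E \<subseteq> U" by blast
qed

text \<open>Intersecting two choice functions pointwise lets the join pass inside the refinement;
  this is what makes entropy subadditive.\<close>

lemma refines_join_common_refinement: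
  "refines (join (common_refinement X I \<U>) (common_refinement X I \<V>))
     (common_refinement X I (\<lambda>i. join (\<U> i) (\<V> i)))"
  unfolding refines_def
proof (intro ballI impI)
  fix E assume "E \<in> join (common_refinement X I \<U>) (common_refinement X I \<V>)"
  then obtain A B where AB: "E = (X \<inter> (\<Inter>i\<in>I. A i)) \<inter> (X \<inter> (\<Inter>i\<in>I. B i))"
    "\<forall>i\<in>I. A i \<in> \<U> i" "\<forall>i\<in>I. B i \<in> \<V> i"
    unfolding join_def common_refinement_def by auto
  have "X \<inter> (\<Inter>i\<in>I. A i \<inter> B i) \<in> common_refinement X I (\<lambda>i. join (\<U> i) (\<V> i))"
    unfolding join_def using AB(2,3) by (intro common_refinementI) auto
  moreover have "E \<subseteq> X \<inter> (\<Inter>i\<in>I. A i \<inter> B i)" using AB(1) by auto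
  ultimately show "\<exists>U\<in>common_refinement X I (\<lambda>i. join (\<U> i) (\<V> i)). E \<subseteq> U" by blast
qed

text \<open>The induction step for finite joins: the member of \<open>\<W> t\<close> overrides the
  choice at \<open>t\<close>.\<close>

lemma refines_join_common_refinement_insert:
  "refines (join (\<W> t) (common_refinement X T \<W>)) (common_refinement X (insert t T) \<W>)"
  unfolding refines_def
proof (intro ballI impI)
  fix E assume "E \<in> join (\<W> t) (common_refinement X T \<W>)"
  then obtain A V where AV: "E = A \<inter> (X \<inter> (\<Inter>i\<in>T. V i))" "A \<in> \<W> t" "\<forall>i\<in>T. V i \<in> \<W> i"
    unfolding join_def common_refinement_def by auto
  let ?V = "V(t := A)"
  have "X \<inter> (\<Inter>i\<in>insert t T. ?V i) \<in> common_refinement X (insert t T) \<W>"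
    using AV(2,3) by (intro common_refinementI) auto
  moreover have "E \<subseteq> X \<inter> (\<Inter>i\<in>insert t T. ?V i)" using AV(1) by auto
  ultimately show "\<exists>U\<in>common_refinement X (insert t T) \<W>. E \<subseteq> U" by blast
qed

section \<open>Translates, nonnegativity and separation of points\<close>

lemma refines_translate_cover:
  assumes "refines \<V> \<U>"
  shows "refines (translate_cover G \<phi> g \<V>) (translate_cover G \<phi> g \<U>)"
  unfolding refines_def translate_cover_def
proof (intro ballI impI)
  fix E assume "E \<in> (`) (\<phi> (inv\<^bsub>G\<^esub> g)) ` \<V>" and ne: "E \<noteq> {}"
  then obtain V where V: "V \<in> \<V>" "E = \<phi> (inv\<^bsub>G\<^esub> g) ` V" by blast
  then obtain U where "U \<in> \<U>" "V \<subseteq> U" using assms ne unfolding refines_def by blast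
  then show "\<exists>U\<in>(`) (\<phi> (inv\<^bsub>G\<^esub> g)) ` \<U>. E \<subseteq> U"
    using V(2) by blast
qed

lemma seq_entropy_cover_nonneg: "0 \<le> seq_entropy_cover G X \<phi> F S \<U>"
proof -
  \<comment> \<open>The convention \<open>ln 0 = 0\<close> settles cover number 0, which occurs for
    empty \<open>X\<close>.\<close>
  have "0 \<le> ln (real n)" for n :: nat by (cases n) auto
  then show ?thesis
    unfolding seq_entropy_cover_def by (intro le_Limsup) (auto intro!: always_eventually)
qed

lemma closed_nbhd_separation:
  fixes X :: "'x::metric_space set"
  assumes "x \<in> X" "y \<in> X" "x \<noteq> y"
  obtains A B where "closed_nbhd X x A" "closed_nbhd X y B" "A \<inter> B = {}"
proof -
  \<comment> \<open>Two closed balls of this radius cannot meet: a common point would give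
    \<open>dist x y \<le> 2 * r\<close>, while \<open>dist x y = 3 * r\<close>.\<close>
  define r where "r = dist x y / 3"
  have r: "r > 0" using assms by (simp add: r_def)
  have nb: "closed_nbhd X z (X \<inter> cball z r)" if "z \<in> X" for z
    unfolding closed_nbhd_def
  proof
    have "X \<inter> ball z r \<subseteq> (top_of_set X) interior_of (X \<inter> cball z r)"
      by (rule interior_of_maximal) auto
    then show "z \<in> (top_of_set X) interior_of (X \<inter> cball z r)" using that r by auto
  qed (simp add: closedin_closed_Int)
  have "(X \<inter> cball x r) \<inter> (X \<inter> cball y r) = {}"
  proof (rule ccontr)
    assume "\<not> ?thesis"
    then obtain z where "dist x z \<le> r" "dist y z \<le> r" by auto
    then have "dist x y \<le> 2 * r" using dist_triangle2[of x y z] by simp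
    then show False using r by (simp add: r_def)
  qed
  then show ?thesis using that nb assms by blast
qed

section \<open>Entropy of covers along one fixed \<open>S\<close>\<close>

locale sequence_of_translates = group_action G X \<phi>
  for G :: "('g, 'm) monoid_scheme" and X :: "'x set" and \<phi> :: "'g \<Rightarrow> 'x \<Rightarrow> 'x" +
  fixes F :: "nat \<Rightarrow> 'g set" and S :: "'g set"
  assumes finite_F: "finite (F n)" and S_carrier: "S \<subseteq> carrier G"
begin

abbreviation cover_along :: "nat \<Rightarrow> 'x set set \<Rightarrow> 'x set set"
  where "cover_along n \<U> \<equiv> common_refinement X (S \<inter> F n) (\<lambda>g. translate_cover G \<phi> g \<U>)"

abbreviation entropy :: "'x set set \<Rightarrow> ereal"
  where "entropy \<equiv> seq_entropy_cover G X \<phi> F S"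

lemma bij_inv: "g \<in> carrier G \<Longrightarrow> bij_betw (\<phi> (inv\<^bsub>G\<^esub> g)) X X"
  using bij_prop0[OF group.inv_closed[OF group_hom.axioms(1)[OF group_hom]]]
  by (simp add: Bij_def)

lemma finite_cover_translate:
  assumes "finite_cover X \<U>" "g \<in> carrier G"
  shows "finite_cover X (translate_cover G \<phi> g \<U>)"
proof -
  have "(\<Union>U\<in>\<U>. \<phi> (inv\<^bsub>G\<^esub> g) ` U) = \<phi> (inv\<^bsub>G\<^esub> g) ` X"
    using assms(1) unfolding finite_cover_def by blast
  then show ?thesis
    using assms bij_inv[OF assms(2)]
    unfolding finite_cover_def translate_cover_def bij_betw_def by simp
qed

text \<open>Images commute with intersections because \<open>\<phi> (inv g)\<close> is injective on
  \<open>X\<close> and all members of the covers lie in \<open>X\<close>.\<close>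

lemma translate_join:
  assumes "finite_cover X \<U>" "finite_cover X \<V>" "g \<in> carrier G"
  shows "translate_cover G \<phi> g (join \<U> \<V>) =
    join (translate_cover G \<phi> g \<U>) (translate_cover G \<phi> g \<V>)"
proof -
  have "\<phi> (inv\<^bsub>G\<^esub> g) ` (A \<inter> B) = \<phi> (inv\<^bsub>G\<^esub> g) ` A \<inter> \<phi> (inv\<^bsub>G\<^esub> g) ` B"
    if "A \<in> \<U>" "B \<in> \<V>" for A B
    using bij_inv[OF assms(3)] assms(1,2) that unfolding bij_betw_def finite_cover_def
    by (intro inj_on_image_Int[where C = X]) auto
  then show ?thesis
    unfolding translate_cover_def join_def
    by (auto simp: image_iff) blast+
qed

lemma finite_cover_along:
  assumes "finite_cover X \<U>"
  shows "finite_cover X (cover_along n \<U>)"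
  using assms finite_F S_carrier
  by (intro finite_cover_common_refinement finite_cover_translate) auto

lemma cover_number_along_mono:
  assumes "finite_cover X \<U>" "finite_cover X \<V>" "refines \<V> \<U>"
  shows "cover_number X (cover_along n \<U>) \<le> cover_number X (cover_along n \<V>)"
  using assms
  by (intro cover_number_mono finite_cover_along refines_common_refinement
      refines_translate_cover)

text \<open>Translation distributes over the join, the join is pulled out of the refinement, and
  cover numbers are submultiplicative.\<close>

lemma cover_number_along_join:
  assumes "finite_cover X \<U>" "finite_cover X \<V>"
  shows "cover_number X (cover_along n (join \<U> \<V>)) \<le>
    cover_number X (cover_along n \<U>) * cover_number X (cover_along n \<V>)"
proof -
  have eq: "cover_along n (join \<U> \<V>) = common_refinement X (S \<inter> F n)
      (\<lambda>g. join (translate_cover G \<phi> g \<U>) (translate_cover G \<phi> g \<V>))"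
    unfolding common_refinement_def
    using translate_join[OF assms] S_carrier by (simp add: subset_iff)
  have "cover_number X (cover_along n (join \<U> \<V>)) \<le>
      cover_number X (join (cover_along n \<U>) (cover_along n \<V>))"
    using assms refines_join_common_refinement
    by (intro cover_number_mono finite_cover_along finite_cover_join) (auto simp: eq)
  also have "\<dots> \<le> cover_number X (cover_along n \<U>) * cover_number X (cover_along n \<V>)"
    using assms by (intro cover_number_join finite_cover_along)
  finally show ?thesis .
qed

text \<open>Holds also for \<open>m = 0\<close>, since \<open>ln 0 = 0\<close> lies below the
  logarithm of every positive integer.\<close>

lemma ln_nat_mono: "m \<le> n \<Longrightarrow> ln (real m) \<le> ln (real n)" for m n :: nat
  by (cases "m = 0"; cases "n = 0") auto

lemma entropy_mono:
  assumes "finite_cover X \<U>" "finite_cover X \<V>" "refines \<V> \<U>"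
  shows "entropy \<U> \<le> entropy \<V>"
  unfolding seq_entropy_cover_def
  using cover_number_along_mono[OF assms]
  by (intro Limsup_mono always_eventually allI)
    (auto intro!: mult_left_mono divide_right_mono ln_nat_mono)

text \<open>The logarithm turns submultiplicativity into subadditivity for each \<open>n\<close>,
  and the upper limit is itself subadditive.\<close>

lemma entropy_join:
  assumes "finite_cover X \<U>" "finite_cover X \<V>"
  shows "entropy (join \<U> \<V>) \<le> entropy \<U> + entropy \<V>"
proof -
  let ?h = "\<lambda>\<U> n. 1 / real (card (S \<inter> F n)) * ln (real (cover_number X (cover_along n \<U>)))"
  have "?h (join \<U> \<V>) n \<le> ?h \<U> n + ?h \<V> n" for n
  proof -
    let ?a = "cover_number X (cover_along n \<U>)" and ?b = "cover_number X (cover_along n \<V>)"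
    have "ln (real (cover_number X (cover_along n (join \<U> \<V>)))) \<le> ln (real (?a * ?b))"
      using cover_number_along_join[OF assms] by (rule ln_nat_mono)
    also have "\<dots> \<le> ln (real ?a) + ln (real ?b)"
      \<comment> \<open>If a factor vanishes, the left side is \<open>ln 0 = 0\<close> and the right
        side is nonnegative; otherwise equality holds.\<close>
      by (cases "?a = 0"; cases "?b = 0") (auto simp: ln_mult)
    finally have "?h (join \<U> \<V>) n \<le>
        1 / real (card (S \<inter> F n)) * (ln (real ?a) + ln (real ?b))"
      by (intro mult_left_mono) auto
    then show ?thesis by (simp add: distrib_left add_divide_distrib)
  qed
  then have "entropy (join \<U> \<V>) \<le> limsup (\<lambda>n. ereal (?h \<U> n) + ereal (?h \<V> n))"
    unfolding seq_entropy_cover_def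
    by (intro Limsup_mono always_eventually allI) simp
  also have "\<dots> \<le> entropy \<U> + entropy \<V>"
    unfolding seq_entropy_cover_def by (rule ereal_limsup_add_mono)
  finally show ?thesis .
qed

text \<open>The base case for finite joins: \<open>\<phi> (inv g)\<close> maps \<open>X\<close> onto
  itself, so every translate of \<open>{X}\<close> is \<open>{X}\<close> and one set suffices to
  cover.\<close>

lemma entropy_trivial: "entropy {X} \<le> 0"
proof -
  have "cover_number X (cover_along n {X}) \<le> 1" for n
  proof -
    have "cover_number X (cover_along n {X}) \<le> cover_number X {X}"
    proof (rule cover_number_mono)
      show "finite_cover X (cover_along n {X})"
        by (rule finite_cover_along) (simp add: finite_cover_def)
      have "V g = X" if "g \<in> S \<inter> F n" "\<forall>i\<in>S \<inter> F n. V i \<in> translate_cover G \<phi> i {X}" for V g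
        using that bij_inv[of g] S_carrier unfolding translate_cover_def bij_betw_def by auto
      moreover have "\<forall>g\<in>S \<inter> F n. X \<in> translate_cover G \<phi> g {X}"
        using bij_inv S_carrier unfolding translate_cover_def bij_betw_def by auto
      ultimately show "refines {X} (cover_along n {X})"
        unfolding refines_def common_refinement_def
        by (auto intro!: exI[where x = X] exI[where x = "\<lambda>_. X"])
    qed (simp add: finite_cover_def)
    also have "\<dots> \<le> card {X}" by (rule cover_number_le) auto
    finally show ?thesis by simp
  qed
  then have "ln (real (cover_number X (cover_along n {X}))) \<le> 0" for n
    using ln_nat_mono[of _ 1] by simp
  then show ?thesis
    unfolding seq_entropy_cover_def
    by (intro Limsup_bounded always_eventually allI) (simp add: divide_nonpos_nonneg)
qed

text \<open>Induction on \<open>T\<close> by subadditivity. In the applications \<open>T\<close>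
  consists of points of the space, not of group elements.\<close>

lemma entropy_common_refinement:
  assumes "finite T" "\<And>t. t \<in> T \<Longrightarrow> finite_cover X (\<W> t)" "\<And>t. t \<in> T \<Longrightarrow> entropy (\<W> t) \<le> 0"
  shows "entropy (common_refinement X T \<W>) \<le> 0"
  using assms
proof (induction T rule: finite_induct)
  case empty
  have "common_refinement X {} \<W> = {X}" by (auto simp: common_refinement_def)
  then show ?case using entropy_trivial by simp
next
  case (insert t T)
  have c: "finite_cover X (\<W> t)" "finite_cover X (common_refinement X T \<W>)"
    "finite_cover X (common_refinement X (insert t T) \<W>)"
    using insert by (auto intro!: finite_cover_common_refinement)
  have "entropy (common_refinement X (insert t T) \<W>) \<le>
      entropy (join (\<W> t) (common_refinement X T \<W>))"
    using c by (intro entropy_mono refines_join_common_refinement_insert finite_cover_join)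
  also have "\<dots> \<le> entropy (\<W> t) + entropy (common_refinement X T \<W>)"
    using c by (intro entropy_join)
  also have "\<dots> \<le> 0 + 0" using insert by (intro add_mono) auto
  finally show ?case by simp
qed

end

section \<open>From separated pairs of points to arbitrary open covers\<close>

text \<open>\<open>separated\<close> is what the absence of sequence entropy pairs says along the
  fixed \<open>S\<close>; here \<open>A\<close> and \<open>B\<close> may depend on
  \<open>S\<close>.\<close>

locale metric_sequence_of_translates = sequence_of_translates G X \<phi> F S
  for G :: "('g, 'm) monoid_scheme" and X :: "'x::metric_space set" and \<phi> F S +
  assumes compact_X: "compact X"
    and separated: "\<And>x y. \<lbrakk>x \<in> X; y \<in> X; x \<noteq> y\<rbrakk> \<Longrightarrow>
      \<exists>A B. closed_nbhd X x A \<and> closed_nbhd X y B \<and> A \<inter> B = {} \<and> entropy {X - A, X - B} \<le> 0"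
begin

text \<open>Serves both compactness arguments, with \<open>C\<close> the complement of an open set
  and then \<open>C = X\<close>. Interiors appear because the \<open>N y\<close> need not be
  open.\<close>

lemma compact_interior_subcover:
  assumes "closedin (top_of_set X) C" "\<And>y. y \<in> C \<Longrightarrow> y \<in> (top_of_set X) interior_of (N y)"
  obtains T where "finite T" "T \<subseteq> C" "C \<subseteq> (\<Union>y\<in>T. (top_of_set X) interior_of (N y))"
proof -
  have "compactin (top_of_set X) C"
    using assms(1) compact_X by (simp add: closedin_compact_space compact_space_subtopology)
  moreover have "C \<subseteq> \<Union>((\<lambda>y. (top_of_set X) interior_of (N y)) ` C)" using assms(2) by blast
  ultimately obtain \<F> where \<F>: "finite \<F>"
      "\<F> \<subseteq> (\<lambda>y. (top_of_set X) interior_of (N y)) ` C" "C \<subseteq> \<Union>\<F>"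
    using compactinD[of "top_of_set X" C "(\<lambda>y. (top_of_set X) interior_of (N y)) ` C"]
      openin_interior_of[of "top_of_set X"] by fastforce
  obtain T where "T \<subseteq> C" "finite T" "\<F> = (\<lambda>y. (top_of_set X) interior_of (N y)) ` T"
    using finite_subset_image[OF \<F>(1,2)] by blast
  then show ?thesis using that \<F>(3) by simp
qed

lemma zero_entropy_nbhd:
  assumes U: "openin (top_of_set X) U" "x \<in> U"
  shows "\<exists>N. x \<in> (top_of_set X) interior_of N \<and> N \<subseteq> U \<and> entropy {X - N, U} \<le> 0"
proof -
  have "U \<subseteq> X" using U(1) openin_imp_subset by blast
  have "\<forall>y\<in>X - U. \<exists>A B. closed_nbhd X x A \<and> closed_nbhd X y B \<and> A \<inter> B = {} \<and>
      entropy {X - A, X - B} \<le> 0"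
    using separated[of x] U \<open>U \<subseteq> X\<close> by blast
  then obtain A B where AB: "\<And>y. y \<in> X - U \<Longrightarrow> closed_nbhd X x (A y)"
      "\<And>y. y \<in> X - U \<Longrightarrow> closed_nbhd X y (B y)" "\<And>y. y \<in> X - U \<Longrightarrow> A y \<inter> B y = {}"
      "\<And>y. y \<in> X - U \<Longrightarrow> entropy {X - A y, X - B y} \<le> 0"
    by metis
  have "closedin (top_of_set X) (X - U)" using U(1) by (simp add: closedin_diff)
  then obtain T where T: "finite T" "T \<subseteq> X - U"
      "X - U \<subseteq> (\<Union>y\<in>T. (top_of_set X) interior_of (B y))"
    using compact_interior_subcover[of "X - U" B] AB(2) unfolding closed_nbhd_def by blast
  \<comment> \<open>The neighbourhoods of \<open>x\<close> paired with the chosen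
    \<open>B y\<close>. For \<open>U = X\<close> the set \<open>T\<close> is empty, and intersecting
    with \<open>X\<close> gives \<open>N = X\<close>.\<close>
  define N where "N = X \<inter> (\<Inter>y\<in>T. A y)"
  have cov: "X - U \<subseteq> (\<Union>y\<in>T. B y)" using T(3) interior_of_subset by fastforce
  have disj: "A y \<inter> B y = {}" if "y \<in> T" for y using that T(2) AB(3) by blast
  \<comment> \<open>A point of \<open>N\<close> outside \<open>U\<close> would lie in some
    \<open>B y\<close>, which is disjoint from \<open>A y\<close> and hence from
    \<open>N\<close>.\<close>
  have "N \<subseteq> U" using cov disj unfolding N_def by blast
  \<comment> \<open>A finite intersection of interiors is an open set between \<open>x\<close> and
    \<open>N\<close>, so \<open>x\<close> is interior to \<open>N\<close>.\<close>
  have "openin (top_of_set X) (X \<inter> (\<Inter>y\<in>T. (top_of_set X) interior_of (A y)))"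
    using T(1) by (cases "T = {}") (auto intro!: openin_Int openin_INT)
  moreover have "X \<inter> (\<Inter>y\<in>T. (top_of_set X) interior_of (A y)) \<subseteq> N"
    unfolding N_def using interior_of_subset by fastforce
  moreover have "x \<in> X \<inter> (\<Inter>y\<in>T. (top_of_set X) interior_of (A y))"
    using U(2) \<open>U \<subseteq> X\<close> AB(1) T(2) unfolding closed_nbhd_def by blast
  ultimately have int: "x \<in> (top_of_set X) interior_of N"
    unfolding interior_of_def by blast
  let ?\<W> = "\<lambda>y. {X - A y, X - B y}"
  have fc: "finite_cover X (?\<W> y)" if "y \<in> T" for y
    using disj[OF that] unfolding finite_cover_def by auto
  have "refines (common_refinement X T ?\<W>) {X - N, U}"
    unfolding refines_def
  proof (intro ballI impI)
    fix E assume "E \<in> common_refinement X T ?\<W>"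
    then obtain V where V: "E = X \<inter> (\<Inter>y\<in>T. V y)" "\<forall>y\<in>T. V y \<in> ?\<W> y"
      by (rule common_refinementE)
    show "\<exists>U'\<in>{X - N, U}. E \<subseteq> U'"
    \<comment> \<open>A cell that avoids one \<open>A y\<close> avoids \<open>N\<close>; any other
      cell avoids every \<open>B y\<close>, and these cover \<open>X - U\<close>.\<close>
    proof (cases "\<exists>y\<in>T. V y = X - A y")
      case True
      then have "E \<subseteq> X - N" using V(1) unfolding N_def by blast
      then show ?thesis by blast
    next
      case False
      then have "\<forall>y\<in>T. V y = X - B y" using V(2) by blast
      then have "E \<subseteq> U" using V(1) cov by blast
      then show ?thesis by blast
    qed
  qed
  then have "entropy {X - N, U} \<le> entropy (common_refinement X T ?\<W>)"
    using T(1) fc \<open>N \<subseteq> U\<close> \<open>U \<subseteq> X\<close>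
    by (intro entropy_mono finite_cover_common_refinement) (auto simp: finite_cover_def)
  also have "\<dots> \<le> 0"
    using T fc AB(4) by (intro entropy_common_refinement) auto
  finally show ?thesis using int \<open>N \<subseteq> U\<close> by blast
qed

lemma entropy_zero:
  assumes "finite_open_cover X \<U>"
  shows "entropy \<U> \<le> 0"
proof -
  have \<U>: "finite_cover X \<U>" using assms by (simp add: finite_open_cover_def finite_cover_def)
  have "\<forall>x\<in>X. \<exists>U N. U \<in> \<U> \<and> x \<in> (top_of_set X) interior_of N \<and> N \<subseteq> U \<and> entropy {X - N, U} \<le> 0"
    using assms zero_entropy_nbhd unfolding finite_open_cover_def by blast
  then obtain U N where UN: "\<And>x. x \<in> X \<Longrightarrow> U x \<in> \<U>"
      "\<And>x. x \<in> X \<Longrightarrow> x \<in> (top_of_set X) interior_of (N x)" "\<And>x. x \<in> X \<Longrightarrow> N x \<subseteq> U x"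
      "\<And>x. x \<in> X \<Longrightarrow> entropy {X - N x, U x} \<le> 0"
    by metis
  obtain T where T: "finite T" "T \<subseteq> X" "X \<subseteq> (\<Union>x\<in>T. (top_of_set X) interior_of (N x))"
    using compact_interior_subcover[of X N] UN(2) by auto
  have cov: "X \<subseteq> (\<Union>x\<in>T. N x)" using T(3) interior_of_subset by fastforce
  let ?\<W> = "\<lambda>x. {X - N x, U x}"
  have fc: "finite_cover X (?\<W> x)" if "x \<in> T" for x
  proof -
    have "x \<in> X" using that T(2) by blast
    then have "U x \<subseteq> X" "N x \<subseteq> U x" using UN \<U> unfolding finite_cover_def by blast+
    then show ?thesis unfolding finite_cover_def by auto
  qed
  have "refines (common_refinement X T ?\<W>) \<U>"
    unfolding refines_def
  proof (intro ballI impI)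
    fix E assume E: "E \<in> common_refinement X T ?\<W>" and ne: "E \<noteq> {}"
    obtain V where V: "E = X \<inter> (\<Inter>x\<in>T. V x)" "\<forall>x\<in>T. V x \<in> ?\<W> x"
      using E by (rule common_refinementE)
    \<comment> \<open>The cell choosing \<open>X - N x\<close> throughout is empty because the
      \<open>N x\<close> cover \<open>X\<close>; every other cell lies in some
      \<open>U x\<close>.\<close>
    have "\<not> (\<forall>x\<in>T. V x = X - N x)" using V(1) ne cov by blast
    then obtain x where "x \<in> T" "V x = U x" using V(2) by blast
    then show "\<exists>U\<in>\<U>. E \<subseteq> U" using V(1) UN(1) T(2) by blast
  qed
  then have "entropy \<U> \<le> entropy (common_refinement X T ?\<W>)"
    using T(1) fc \<U> by (intro entropy_mono finite_cover_common_refinement)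
  also have "\<dots> \<le> 0"
    using T fc UN(4) by (intro entropy_common_refinement) auto
  finally show ?thesis .
qed

end

section \<open>Nullness versus the absence of sequence entropy pairs\<close>

theorem theorem5p4:
  fixes G :: "('g, 'm) monoid_scheme"
    and F :: "nat \<Rightarrow> 'g set"
    and X :: "'x::metric_space set"
    and \<phi> :: "'g \<Rightarrow> 'x \<Rightarrow> 'x"
  assumes "group G" and "countable (carrier G)" and "infinite (carrier G)"
    and "amenable G"
    and "folner_sequence G F"
    and "G_system G X \<phi>"
  shows "null_system G X \<phi> F \<longleftrightarrow> sequence_entropy_pairs G X \<phi> F = {}"
proof
  assume null: "null_system G X \<phi> F"
  show "sequence_entropy_pairs G X \<phi> F = {}"
  proof (rule ccontr)
    assume "sequence_entropy_pairs G X \<phi> F \<noteq> {}"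
    then obtain x y where "(x, y) \<in> sequence_entropy_pairs G X \<phi> F" by auto
    then have xy: "x \<in> X" "y \<in> X" "x \<noteq> y"
      and pos: "\<forall>A B. closed_nbhd X x A \<and> closed_nbhd X y B \<and> A \<inter> B = {} \<longrightarrow>
        (\<exists>S. S \<subseteq> carrier G \<and> infinite S \<and> seq_entropy_cover G X \<phi> F S {X - A, X - B} > 0)"
      unfolding sequence_entropy_pairs_def by simp_all
    obtain A B where AB: "closed_nbhd X x A" "closed_nbhd X y B" "A \<inter> B = {}"
      using closed_nbhd_separation[OF xy] .
    obtain S where S: "S \<subseteq> carrier G" "infinite S"
        "seq_entropy_cover G X \<phi> F S {X - A, X - B} > 0"
      using pos AB by blast
    \<comment> \<open>Closedness of \<open>A\<close> and \<open>B\<close> makes the complements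
      open, and disjointness makes them cover \<open>X\<close>.\<close>
    have "finite_open_cover X {X - A, X - B}"
      using AB unfolding finite_open_cover_def closed_nbhd_def by (auto simp: closedin_def)
    then have "seq_entropy_cover G X \<phi> F S {X - A, X - B} \<le> seq_entropy G X \<phi> F S"
      unfolding seq_entropy_def by (intro SUP_upper) simp
    then show False using null S unfolding null_system_def by auto
  qed
next
  assume empty: "sequence_entropy_pairs G X \<phi> F = {}"
  show "null_system G X \<phi> F"
    unfolding null_system_def
  proof (intro allI impI)
    fix S assume S: "S \<subseteq> carrier G \<and> infinite S"
    interpret group_action G X \<phi> using assms(6) by (simp add: G_system_def)
    interpret metric_sequence_of_translates G X \<phi> F S
    proof unfold_locales
      show "finite (F n)" for n
        using assms(5) by (simp add: folner_sequence_def asymptotically_invariant_def)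
      show "S \<subseteq> carrier G" using S by simp
      show "compact X" using assms(6) by (simp add: G_system_def)
      fix x y assume "x \<in> X" "y \<in> X" "x \<noteq> y"
      moreover have "(x, y) \<notin> sequence_entropy_pairs G X \<phi> F" using empty by simp
      \<comment> \<open>Failing to be a pair gives neighbourhoods whose cover has positive entropy
        along no infinite sequence, in particular not along \<open>S\<close>.\<close>
      ultimately obtain A B where "closed_nbhd X x A" "closed_nbhd X y B" "A \<inter> B = {}"
        "\<not> seq_entropy_cover G X \<phi> F S {X - A, X - B} > 0"
        using S unfolding sequence_entropy_pairs_def by auto
      then show "\<exists>A B. closed_nbhd X x A \<and> closed_nbhd X y B \<and> A \<inter> B = {} \<and>
          seq_entropy_cover G X \<phi> F S {X - A, X - B} \<le> 0"
        using not_less by blast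
    qed
    \<comment> \<open>The lower bound needs one cover in the supremum, since an empty supremum in
      \<open>ereal\<close> would be minus infinity.\<close>
    have "finite_open_cover X {X}" by (simp add: finite_open_cover_def)
    then have "seq_entropy_cover G X \<phi> F S {X} \<le> seq_entropy G X \<phi> F S"
      unfolding seq_entropy_def by (intro SUP_upper) simp
    then have "0 \<le> seq_entropy G X \<phi> F S"
      using seq_entropy_cover_nonneg order_trans by blast
    moreover have "seq_entropy G X \<phi> F S \<le> 0"
      unfolding seq_entropy_def by (intro SUP_least entropy_zero) simp
    ultimately show "seq_entropy G X \<phi> F S = 0" by simp
  qed
qed

end
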